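(* Let $H$ be a contextuality scenario. A probabilistic model $p\in\mathcal{G}(H)$ is extremal (i.e. an extreme point of the convex polytope $\mathcal{G}(H)\subseteq\mathbb{R}^{V(H)}$) if and only if there is a subset $W\subseteq V(H)$ such that the induced subscenario $H_W$ has a unique probabilistic model $p_W$, and $p$ is the extension of $p_W$ from $H_W$ to $H$.
   Context: A contextuality scenario is a hypergraph $H$ with finite nonempty vertex set $V(H)$ and edge set $E(H)\subseteq 2^{V(H)}$ such that $\bigcup_{e\in E(H)}e=V(H)$. A probabilistic model on a hypergraph $H$ is a map $p:V(H)\to[0,1]$ with $\sum_{v\in e}p(v)=1$ for all $e\in E(H)$; the set of all of them is $\mathcal{G}(H)$. For $W\subseteq V(H)$, the induced subscenario $H_W$ is the hypergraph with $V(H_W)=W$ and $E(H_W)=\{e\cap W: e\in E(H)\}$. For $p_W\in\mathcal{G}(H_W)$, its extension from $H_W$ to $H$ is the map $p$ with $p(v)=p_W(v)$ for $v\in W$ and $p(v)=0$ for $v\notin W$. *)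

theory Defs
  imports "HOL-Analysis.Analysis" "HOL-Library.Function_Algebras"
begin

text \<open>
  The pointwise real vector space structure on functions, which makes the library notions of
  convexity and extreme points applicable to sets of functions.
\<close>

instantiation "fun" :: (type, real_vector) real_vector
begin

definition scaleR_fun :: "real \<Rightarrow> ('a \<Rightarrow> 'b) \<Rightarrow> 'a \<Rightarrow> 'b"
  where "scaleR_fun r f = (\<lambda>x. r *\<^sub>R f x)"

instance
  by standard (simp_all add: scaleR_fun_def fun_eq_iff scaleR_add_right scaleR_add_left)

end

lemma scaleR_fun_apply [simp]: "(r *\<^sub>R f) x = r *\<^sub>R f x"
  by (simp add: scaleR_fun_def)

record 'v hypergraph =
  verts :: "'v set"
  edges :: "'v set set"

definition contextuality_scenario :: "'v hypergraph \<Rightarrow> bool"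
  where "contextuality_scenario H \<longleftrightarrow>
    finite (verts H) \<and> verts H \<noteq> {} \<and> edges H \<subseteq> Pow (verts H) \<and> \<Union>(edges H) = verts H"

text \<open>
  A map defined on the vertex set only is represented by an extensional function, i.e. one that
  takes the fixed value \<^term>\<open>undefined\<close> outside the vertex set. Extensional functions are closed
  under \<open>(1 - u) *\<^sub>R f + u *\<^sub>R g\<close>, so segments between models are exactly the segments in the space
  of real functions on the vertex set.
\<close>

definition prob_models :: "'v hypergraph \<Rightarrow> ('v \<Rightarrow> real) set"
  where "prob_models H = {p \<in> verts H \<rightarrow>\<^sub>E {0..1}. \<forall>e\<in>edges H. (\<Sum>v\<in>e. p v) = 1}"

text \<open>
  If some edge of \<open>H\<close> is disjoint from \<open>W\<close>, then \<open>{}\<close> is an edge of the induced subscenario, which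
  then has no probabilistic model, as the empty sum is not 1.
\<close>

definition induced_subscenario :: "'v hypergraph \<Rightarrow> 'v set \<Rightarrow> 'v hypergraph"
  where "induced_subscenario H W = \<lparr>verts = W, edges = {e \<inter> W | e. e \<in> edges H}\<rparr>"

definition extension :: "'v hypergraph \<Rightarrow> 'v set \<Rightarrow> ('v \<Rightarrow> real) \<Rightarrow> 'v \<Rightarrow> real"
  where "extension H W q = (\<lambda>v\<in>verts H. if v \<in> W then q v else 0)"

lemma convex_prob_models: "convex (prob_models H)"
proof (rule convexI)
  fix p q :: "'a \<Rightarrow> real" and u v :: real
  assume p: "p \<in> prob_models H" and q: "q \<in> prob_models H"
    and uv: "0 \<le> u" "0 \<le> v" "u + v = 1"
  have "u * p x + v * q x \<in> {0..1}" if "x \<in> verts H" for x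
  proof -
    have "p x \<in> {0..1}" "q x \<in> {0..1}"
      using p q that by (auto simp: prob_models_def)
    then show ?thesis
      using convexD[OF convex_real_interval(5)[of 0 1], of "p x" "q x" u v] uv by simp
  qed
  moreover have "u * p x + v * q x = undefined" if "x \<notin> verts H" for x
  proof -
    have "p x = undefined" "q x = undefined"
      using p q that by (auto simp: prob_models_def)
    then show ?thesis
      using uv by (simp flip: distrib_right)
  qed
  moreover have "(\<Sum>x\<in>e. u * p x + v * q x) = 1" if "e \<in> edges H" for e
    using p q uv that by (simp add: prob_models_def sum.distrib flip: sum_distrib_left)
  ultimately show "u *\<^sub>R p + v *\<^sub>R q \<in> prob_models H"
    by (auto simp: prob_models_def PiE_iff extensional_def)
qed

end

theory Submission
  imports Defs
begin

text \<open>
  An extremal model is the only one living on its support \<open>W\<close>: since it is positive on \<open>W\<close>, the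
  segment from any other model supported in \<open>W\<close> can be prolonged a little beyond it. Conversely, if
  a model vanishing off \<open>W\<close> is a proper convex combination of two models, these vanish off \<open>W\<close>
  as well, so uniqueness on \<open>W\<close> makes them equal.
\<close>

text \<open>Every vertex lies in some edge, whose nonnegative values sum to 1, so the upper bound 1
  is automatic. A perturbed model thus only has to be kept from becoming negative.\<close>

lemma prob_models_iff:
  assumes "contextuality_scenario H"
  shows "p \<in> prob_models H \<longleftrightarrow>
    (\<forall>v\<in>verts H. 0 \<le> p v) \<and> p \<in> extensional (verts H) \<and> (\<forall>e\<in>edges H. (\<Sum>v\<in>e. p v) = 1)"
proof -
  have "p v \<le> 1"
    if nonneg: "\<forall>v\<in>verts H. 0 \<le> p v" and sums: "\<forall>e\<in>edges H. (\<Sum>v\<in>e. p v) = 1"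
      and v: "v \<in> verts H" for v
  proof -
    obtain e where e: "e \<in> edges H" "v \<in> e"
      using assms v unfolding contextuality_scenario_def by blast
    have "e \<subseteq> verts H" and "finite (verts H)"
      using assms e by (auto simp: contextuality_scenario_def)
    then have "p v \<le> (\<Sum>v\<in>e. p v)"
      using nonneg e by (intro member_le_sum) (auto intro: finite_subset)
    then show ?thesis
      using sums e by simp
  qed
  then show ?thesis
    by (auto simp: prob_models_def PiE_iff)
qed

lemma extension_restrict:
  assumes "p \<in> extensional (verts H)" and "W \<subseteq> verts H" and "\<And>v. v \<in> verts H - W \<Longrightarrow> p v = 0"
  shows "extension H W (restrict p W) = p"
  using assms by (auto simp: extension_def fun_eq_iff extensional_def)

lemma sum_edge_Int:
  fixes p :: "'v \<Rightarrow> real"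
  assumes "contextuality_scenario H" and "e \<in> edges H" and "\<And>v. v \<in> verts H - W \<Longrightarrow> p v = 0"
  shows "(\<Sum>v\<in>e \<inter> W. p v) = (\<Sum>v\<in>e. p v)"
proof (rule sum.mono_neutral_left)
  show "finite e"
    using assms(1,2) by (auto simp: contextuality_scenario_def intro: finite_subset)
  show "\<forall>v\<in>e - e \<inter> W. p v = 0"
    using assms by (auto simp: contextuality_scenario_def)
qed auto

text \<open>Dropping vertices of value 0 changes no edge sum. Models of \<open>H\<close> vanishing
  off \<open>W\<close> thus correspond to models of the induced subscenario;
  \<open>extension_in_prob_models\<close> is the way back.\<close>

lemma restrict_in_prob_models:
  assumes H: "contextuality_scenario H" and p: "p \<in> prob_models H"
    and W: "W \<subseteq> verts H" and zero: "\<And>v. v \<in> verts H - W \<Longrightarrow> p v = 0"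
  shows "restrict p W \<in> prob_models (induced_subscenario H W)"
proof -
  have "(\<Sum>v\<in>e \<inter> W. restrict p W v) = 1" if "e \<in> edges H" for e
    using sum_edge_Int[where p = p, OF H that zero] p that by (simp add: prob_models_def)
  then show ?thesis
    using p W by (auto simp: prob_models_def induced_subscenario_def PiE_iff)
qed

lemma extension_in_prob_models:
  assumes H: "contextuality_scenario H" and W: "W \<subseteq> verts H"
    and q: "q \<in> prob_models (induced_subscenario H W)"
  shows "extension H W q \<in> prob_models H"
proof -
  have "(\<Sum>v\<in>e. extension H W q v) = 1" if e: "e \<in> edges H" for e
  proof -
    have "(\<Sum>v\<in>e. extension H W q v) = (\<Sum>v\<in>e \<inter> W. extension H W q v)"
      by (rule sum_edge_Int[OF H e, symmetric]) (simp add: extension_def)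
    also have "\<dots> = (\<Sum>v\<in>e \<inter> W. q v)"
      using W by (intro sum.cong) (auto simp: extension_def)
    also have "\<dots> = 1"
      using q e by (auto simp: prob_models_def induced_subscenario_def)
    finally show ?thesis .
  qed
  then show ?thesis
    using q by (auto simp: prob_models_def induced_subscenario_def extension_def PiE_iff)
qed

text \<open>On the support of \<open>p\<close> there is room to move slightly from \<open>p\<close>
  away from \<open>r\<close>, and off it both vanish. If \<open>r\<close> differed from
  \<open>p\<close>, then \<open>p\<close> would lie strictly between \<open>r\<close> and the point
  so reached.\<close>

lemma extreme_point_eqI_supported:
  assumes H: "contextuality_scenario H" and p: "p extreme_point_of prob_models H"
    and r: "r \<in> prob_models H" and supp: "\<And>v. v \<in> verts H \<Longrightarrow> p v = 0 \<Longrightarrow> r v = 0"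
  shows "r = p"
proof -
  have pm: "p \<in> prob_models H"
    using p by (simp add: extreme_point_of_def)
  \<comment> \<open>The least nonzero value of \<open>p\<close>, capped at 1; the inserted 1 makes
    the set over which \<open>Min\<close> is taken visibly nonempty.\<close>
  define \<epsilon> where "\<epsilon> = Min (insert 1 (p ` {v \<in> verts H. p v \<noteq> 0}))"
  have fin: "finite (verts H)"
    using H by (simp add: contextuality_scenario_def)
  have bounds: "0 \<le> p v" "r v \<le> 1" if "v \<in> verts H" for v
    using pm r that by (auto simp: prob_models_def)
  have pos: "0 < \<epsilon>"
    unfolding \<epsilon>_def using fin bounds(1) by (subst Min_gr_iff) (auto simp: less_le)
  have le: "\<epsilon> \<le> p v" if "v \<in> verts H" "p v \<noteq> 0" for v
    using fin that by (auto simp: \<epsilon>_def intro!: Min_le)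
  \<comment> \<open>The point beyond \<open>p\<close> on the ray from \<open>r\<close> through
    \<open>p\<close>.\<close>
  define s where "s = (\<lambda>v. p v + \<epsilon> * (p v - r v))"
  have "0 \<le> s v" if v: "v \<in> verts H" for v
  proof (cases "p v = 0")
    case True
    then show ?thesis
      using supp v by (simp add: s_def)
  next
    case False
    \<comment> \<open>The amount subtracted from \<open>p v\<close> is at most
      \<open>\<epsilon>\<close>, because \<open>r v\<close> is at most 1, and
      \<open>\<epsilon>\<close> is at most \<open>p v\<close> on the support.\<close>
    have "\<epsilon> * r v \<le> \<epsilon>"
      using mult_left_le[OF bounds(2)[OF v]] pos by simp
    also have "\<epsilon> \<le> p v"
      using le[OF v False] .
    also have "\<dots> \<le> p v + \<epsilon> * p v"
      using bounds(1)[OF v] pos by simp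
    finally show ?thesis
      by (simp add: s_def algebra_simps)
  qed
  \<comment> \<open>Off the vertex set \<open>p\<close> and \<open>r\<close> both equal
    \<open>undefined\<close>, so the correction term cancels.\<close>
  moreover have "s \<in> extensional (verts H)"
    using pm r by (auto simp: s_def prob_models_def PiE_iff extensional_def)
  moreover have "(\<Sum>v\<in>e. s v) = 1" if "e \<in> edges H" for e
    using pm r that
    by (simp add: s_def prob_models_def sum.distrib sum_subtractf flip: sum_distrib_left)
  ultimately have s: "s \<in> prob_models H"
    using prob_models_iff[OF H] by blast
  \<comment> \<open>Solving the definition of \<open>s\<close> for \<open>p\<close> gives
    \<open>p = (s + \<epsilon> * r) / (1 + \<epsilon>)\<close>; this \<open>t\<close> is the weight
    of \<open>r\<close>.\<close>
  define t where "t = \<epsilon> / (1 + \<epsilon>)"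
  have t: "0 < t" "t < 1"
    using pos by (auto simp: t_def)
  have "p = (1 - t) *\<^sub>R s + t *\<^sub>R r"
  proof
    fix v
    have "1 - t = 1 / (1 + \<epsilon>)"
      using pos by (simp add: t_def field_simps)
    then have "(1 - t) * s v + t * r v = (s v + \<epsilon> * r v) / (1 + \<epsilon>)"
      by (simp add: t_def add_divide_distrib)
    also have "\<dots> = p v"
      using pos by (simp add: s_def field_simps)
    finally show "p v = ((1 - t) *\<^sub>R s + t *\<^sub>R r) v"
      by simp
  qed
  moreover have "p \<notin> open_segment s r"
    \<comment> \<open>Extremality leaves only a degenerate segment. As \<open>s - r\<close> is
      \<open>(1 + \<epsilon>) * (p - r)\<close> pointwise, \<open>s = r\<close> will force
      \<open>r = p\<close>.\<close>
    using p s r by (simp add: extreme_point_of_def)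
  ultimately have "s = r"
    using t by (auto simp: in_segment)
  have "r v = p v" for v
  proof -
    have "p v + \<epsilon> * (p v - r v) = r v"
      using fun_cong[OF \<open>s = r\<close>, of v] by (simp add: s_def)
    then have "(1 + \<epsilon>) * (p v - r v) = 0"
      by (simp add: algebra_simps)
    then show ?thesis
      using pos by auto
  qed
  then show ?thesis ..
qed

lemma convex_combination_eq_0:
  fixes a b :: real
  assumes "0 \<le> a" "0 \<le> b" "0 < t" "t < 1" "(1 - t) * a + t * b = 0"
  shows "a = 0" "b = 0"
  using assms by (auto simp: add_nonneg_eq_0_iff)

theorem theorem2p5p3:
  fixes H :: "'v hypergraph" and p :: "'v \<Rightarrow> real"
  assumes "contextuality_scenario H"
    and "p \<in> prob_models H"
  shows "p extreme_point_of prob_models H \<longleftrightarrow>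
    (\<exists>W \<subseteq> verts H. \<exists>p\<^sub>W. prob_models (induced_subscenario H W) = {p\<^sub>W} \<and> p = extension H W p\<^sub>W)"
proof
  assume ext: "p extreme_point_of prob_models H"
  \<comment> \<open>The witness is the support of \<open>p\<close>, so that any extension from
    \<open>W\<close> vanishes wherever \<open>p\<close> does.\<close>
  define W where "W = {v \<in> verts H. p v \<noteq> 0}"
  have W: "W \<subseteq> verts H" and zero: "\<And>v. v \<in> verts H - W \<Longrightarrow> p v = 0"
    by (auto simp: W_def)
  have "q = restrict p W" if q: "q \<in> prob_models (induced_subscenario H W)" for q
  proof -
    have "extension H W q = p"
    proof (rule extreme_point_eqI_supported[OF assms(1) ext])
      show "extension H W q \<in> prob_models H"
        using extension_in_prob_models[OF assms(1) W q] .
    qed (simp add: extension_def W_def)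
    moreover have "q \<in> extensional W"
      using q by (auto simp: prob_models_def induced_subscenario_def PiE_iff)
    ultimately show ?thesis
      using W by (intro extensionalityI[of _ W]) (auto simp: extension_def)
  qed
  moreover have "restrict p W \<in> prob_models (induced_subscenario H W)"
    using restrict_in_prob_models[OF assms W zero] .
  moreover have "p = extension H W (restrict p W)"
    using assms(2) extension_restrict[OF _ W zero] by (auto simp: prob_models_def PiE_iff)
  ultimately show "\<exists>W \<subseteq> verts H. \<exists>p\<^sub>W.
      prob_models (induced_subscenario H W) = {p\<^sub>W} \<and> p = extension H W p\<^sub>W"
    using W by blast
next
  assume "\<exists>W \<subseteq> verts H. \<exists>p\<^sub>W.
    prob_models (induced_subscenario H W) = {p\<^sub>W} \<and> p = extension H W p\<^sub>W"
  then obtain W q where W: "W \<subseteq> verts H"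
    and q: "prob_models (induced_subscenario H W) = {q}"
    and pq: "p = extension H W q"
    by blast
  \<comment> \<open>Uniqueness is transferred from the subscenario to \<open>H\<close>:
    \<open>c\<close> is recovered from its restriction, which can only be \<open>q\<close>.\<close>
  have unique: "c = p"
    if c: "c \<in> prob_models H" and zero: "\<And>v. v \<in> verts H - W \<Longrightarrow> c v = 0" for c
  proof -
    have "restrict c W = q"
      using restrict_in_prob_models[OF assms(1) c W zero] q by simp
    moreover have "extension H W (restrict c W) = c"
      using c by (intro extension_restrict[OF _ W zero]) (auto simp: prob_models_def PiE_iff)
    ultimately show ?thesis
      using pq by simp
  qed
  have "p \<notin> open_segment a b" if a: "a \<in> prob_models H" and b: "b \<in> prob_models H" for a b
  proof
    assume "p \<in> open_segment a b"
    then obtain t where ab: "a \<noteq> b" and t: "0 < t" "t < 1" and p: "p = (1 - t) *\<^sub>R a + t *\<^sub>R b"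
      by (auto simp: in_segment)
    \<comment> \<open>Since \<open>p\<close> is 0 off \<open>W\<close>, two nonnegative values with
      positive weights add up to 0 there, so both vanish.\<close>
    have "a v = 0 \<and> b v = 0" if v: "v \<in> verts H - W" for v
    proof -
      have "(1 - t) * a v + t * b v = 0"
        using fun_cong[OF p, of v] v pq by (simp add: extension_def)
      moreover have "0 \<le> a v" "0 \<le> b v"
        using a b v by (auto simp: prob_models_def)
      ultimately show ?thesis
        using convex_combination_eq_0 t by blast
    qed
    then have "a = p" "b = p"
      using unique[OF a] unique[OF b] by blast+
    then show False
      using ab by simp
  qed
  then show "p extreme_point_of prob_models H"
    using assms(2) by (simp add: extreme_point_of_def)
qed

end
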